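(* Let $a>0$ with $a\neq 1$, and let $\sigma:\mathbb{R}\to\mathbb{R}$ be a twice differentiable function with $\sigma(t)>0$, $\sigma'(t)>0$ and $\sigma''(t)>0$ for all $t>0$, and such that $$\sigma''(t)\,\sigma(t)\ \ge\ (\sigma'(t))^2\qquad\text{for all } t>0.$$ Let $n\ge 1$, let $d_0,\dots,d_n\ge 1$, and let $x\in\mathbb{R}^{d_0}$ have all entries strictly positive. For $W=(W_0,\dots,W_{n-1})$ with $W_k\in\mathbb{R}^{d_{k+1}\times d_k}$, define the $n$-layer exponential multilayer neural network by $x^{(0)}=x$, $$x^{(k+1)}=\sigma\big(a^{W_k}x^{(k)}\big)\quad (0\le k\le n-2),\qquad f_{a,n}(W,x)=a^{W_{n-1}}x^{(n-1)}.$$ Then $f_{a,n}(W,x)$ is a Parameter Convex Neural Network, i.e. it is convex with respect to $W$.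
   Context: For a real matrix $M$ and $a>0$, $a^{M}$ denotes the matrix of the same size with entries $a^{M_{ij}}$ (entrywise exponential); products such as $a^{W_k}x^{(k)}$ are ordinary matrix products. A scalar function $\sigma$ applied to a vector acts entrywise. A matrix- or vector-valued function of parameters $W$ (a tuple of matrices) is called convex with respect to $W$ if each of its entries is a convex real-valued function of the column vector obtained by listing all the entries of $W$. A neural network $F(x,\theta)$ with input $x$ and parameters $\theta$ is a Parameter Convex Neural Network (PCNN) if it is convex with respect to $\theta$ (for each admissible fixed input $x$). *)

theory Defs
  imports
    "HOL-Analysis.Convex"
    "HOL-Analysis.Finite_Function_Topology"
    "Jordan_Normal_Form.Matrix"
begin

text \<open>
  A parameter is a tuple of \<open>n\<close> real matrices whose \<open>k\<close>-th component has \<open>r k\<close> rows and \<open>c k\<close>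
  columns. The vector listing all of its entries is represented with coordinates labelled by
  the positions \<open>(k, i, j)\<close> of the entries: the real vector space of entry vectors consists of the
  finitely supported functions whose support is contained in the finite set of positions. In this
  way \<^const>\<open>convex_on\<close> applies, although the dimension is not fixed by a type.
\<close>

definition entry_positions :: "nat \<Rightarrow> (nat \<Rightarrow> nat) \<Rightarrow> (nat \<Rightarrow> nat) \<Rightarrow> (nat \<times> nat \<times> nat) set" where
  "entry_positions n r c = {(k, i, j). k < n \<and> i < r k \<and> j < c k}"

definition entry_vectors :: "nat \<Rightarrow> (nat \<Rightarrow> nat) \<Rightarrow> (nat \<Rightarrow> nat) \<Rightarrow> (nat \<times> nat \<times> nat \<Rightarrow>\<^sub>0 real) set" where
  "entry_vectors n r c = {w. Poly_Mapping.keys w \<subseteq> entry_positions n r c}"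

text \<open>
  The tuple of matrices with a given vector of entries; only the components with index below \<open>n\<close>
  belong to the tuple. This is a linear bijection from \<open>entry_vectors n r c\<close> onto the tuples of
  matrices of the given shapes.
\<close>

definition matrices_of_entries ::
    "(nat \<Rightarrow> nat) \<Rightarrow> (nat \<Rightarrow> nat) \<Rightarrow> (nat \<times> nat \<times> nat \<Rightarrow>\<^sub>0 real) \<Rightarrow> (nat \<Rightarrow> real mat)" where
  "matrices_of_entries r c w =
     (\<lambda>k. mat (r k) (c k) (\<lambda>(i, j). Poly_Mapping.lookup w (k, i, j)))"

definition convex_wrt_matrices ::
    "nat \<Rightarrow> (nat \<Rightarrow> nat) \<Rightarrow> (nat \<Rightarrow> nat) \<Rightarrow> nat \<Rightarrow> ((nat \<Rightarrow> real mat) \<Rightarrow> real vec) \<Rightarrow> bool" where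
  "convex_wrt_matrices n r c m F \<longleftrightarrow>
     (\<forall>w \<in> entry_vectors n r c. F (matrices_of_entries r c w) \<in> carrier_vec m) \<and>
     (\<forall>i < m. convex_on (entry_vectors n r c) (\<lambda>w. vec_index (F (matrices_of_entries r c w)) i))"

text \<open>The set \<open>X\<close> consists of the admissible inputs, and \<open>m\<close> is the output dimension.\<close>

definition parameter_convex_nn ::
    "nat \<Rightarrow> (nat \<Rightarrow> nat) \<Rightarrow> (nat \<Rightarrow> nat) \<Rightarrow> nat \<Rightarrow> real vec set \<Rightarrow>
     (real vec \<Rightarrow> (nat \<Rightarrow> real mat) \<Rightarrow> real vec) \<Rightarrow> bool" where
  "parameter_convex_nn n r c m X F \<longleftrightarrow> (\<forall>x \<in> X. convex_wrt_matrices n r c m (F x))"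

definition positive_vecs :: "nat \<Rightarrow> real vec set" where
  "positive_vecs m = {x \<in> carrier_vec m. \<forall>i < m. vec_index x i > 0}"

definition exp_mat :: "real \<Rightarrow> real mat \<Rightarrow> real mat" where
  "exp_mat a M = map_mat (\<lambda>y. a powr y) M"

primrec exp_layer :: "real \<Rightarrow> (real \<Rightarrow> real) \<Rightarrow> (nat \<Rightarrow> real mat) \<Rightarrow> real vec \<Rightarrow> nat \<Rightarrow> real vec" where
  "exp_layer a \<sigma> W x 0 = x"
| "exp_layer a \<sigma> W x (Suc k) = map_vec \<sigma> (mult_mat_vec (exp_mat a (W k)) (exp_layer a \<sigma> W x k))"

text \<open>Meant for \<open>n \<ge> 1\<close>; the activation is not applied after the last matrix.\<close>

definition exp_network ::
    "real \<Rightarrow> (real \<Rightarrow> real) \<Rightarrow> nat \<Rightarrow> real vec \<Rightarrow> (nat \<Rightarrow> real mat) \<Rightarrow> real vec" where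
  "exp_network a \<sigma> n x W = mult_mat_vec (exp_mat a (W (n - 1))) (exp_layer a \<sigma> W x (n - 1))"

end

theory Submission
  imports Defs
begin

text \<open>
  Logarithmic convexity, unlike convexity, survives products and sums of positive functions. Every
  entry \<open>a\<^bsup>w\<^esup>\<close> of an exponential weight matrix is log-affine in \<open>w\<close>, and the condition
  \<open>\<sigma>'' \<sigma> \<ge> \<sigma>'\<^sup>2\<close> says that \<open>ln \<circ> \<sigma>\<close> is convex; as it is also increasing, \<open>\<sigma>\<close> maps log-convex functions to
  log-convex functions. By induction over the layers all entries of the network are log-convex in
  the parameters, hence convex.
\<close>

section \<open>Log-convex functions and their closure properties\<close>

definition log_convex_on :: "'a::real_vector set \<Rightarrow> ('a \<Rightarrow> real) \<Rightarrow> bool" where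
  "log_convex_on S f \<longleftrightarrow> (\<forall>x\<in>S. f x > 0) \<and> convex_on S (\<lambda>x. ln (f x))"

lemma log_convex_on_pos: "log_convex_on S f \<Longrightarrow> x \<in> S \<Longrightarrow> f x > 0"
  by (simp add: log_convex_on_def)

lemma log_convex_on_imp_convex: "log_convex_on S f \<Longrightarrow> convex S"
  by (auto simp: log_convex_on_def dest: convex_on_imp_convex)

text \<open>Exponentiating the convexity inequality for \<open>ln (f x)\<close> yields a bound by a
  weighted geometric mean. This form suits sums and compositions, where the logarithm does not
  simplify.\<close>

lemma log_convex_on_iff:
  "log_convex_on S f \<longleftrightarrow> convex S \<and> (\<forall>x\<in>S. f x > 0) \<and>
    (\<forall>x\<in>S. \<forall>y\<in>S. \<forall>u\<ge>0. \<forall>v\<ge>0. u + v = 1 \<longrightarrow>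
      f (u *\<^sub>R x + v *\<^sub>R y) \<le> f x powr u * f y powr v)"
proof (cases "convex S \<and> (\<forall>x\<in>S. f x > 0)")
  case True
  have "ln (f (u *\<^sub>R x + v *\<^sub>R y)) \<le> u * ln (f x) + v * ln (f y) \<longleftrightarrow>
        f (u *\<^sub>R x + v *\<^sub>R y) \<le> f x powr u * f y powr v"
    if "x \<in> S" "y \<in> S" "u \<ge> 0" "v \<ge> 0" "u + v = 1" for x y u v
  proof -
    have "u *\<^sub>R x + v *\<^sub>R y \<in> S"
      using True that by (simp add: convexD)
    then have pos: "f x > 0" "f y > 0" "f (u *\<^sub>R x + v *\<^sub>R y) > 0"
      using True that by auto
    then have "f x powr u * f y powr v = exp (u * ln (f x) + v * ln (f y))"
      by (simp add: powr_def exp_add)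
    then show ?thesis
      using pos by (metis exp_le_cancel_iff exp_ln)
  qed
  with True show ?thesis
    by (simp add: log_convex_on_def convex_on_def)
next
  case False
  then show ?thesis
    by (auto simp: log_convex_on_def convex_on_def)
qed

text \<open>By weighted AM-GM, the geometric mean in \<open>log_convex_on_iff\<close> is at most the
  arithmetic mean.\<close>

lemma log_convex_on_imp_convex_on:
  assumes "log_convex_on S f"
  shows "convex_on S f"
  unfolding convex_on_def
proof (intro conjI ballI allI impI)
  show "convex S"
    using assms by (rule log_convex_on_imp_convex)
  fix x y and u v :: real
  assume *: "x \<in> S" "y \<in> S" "u \<ge> 0" "v \<ge> 0" "u + v = 1"
  have "f (u *\<^sub>R x + v *\<^sub>R y) \<le> f x powr u * f y powr v"
    using assms * by (auto simp: log_convex_on_iff)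
  also have "\<dots> \<le> u * f x + v * f y"
    using assms * by (intro Youngs_inequality_0) (auto simp: log_convex_on_pos)
  finally show "f (u *\<^sub>R x + v *\<^sub>R y) \<le> u * f x + v * f y" .
qed

lemma log_convex_on_mult:
  assumes "log_convex_on S f" "log_convex_on S g"
  shows "log_convex_on S (\<lambda>x. f x * g x)"
proof -
  have pos: "f x > 0" "g x > 0" if "x \<in> S" for x
    using assms that by (auto simp: log_convex_on_pos)
  have sum: "convex_on S (\<lambda>x. ln (f x) + ln (g x))"
    using assms by (simp add: log_convex_on_def convex_on_add)
  have ln: "ln (f x * g x) = ln (f x) + ln (g x)" if "x \<in> S" for x
    using pos[OF that] by (simp add: ln_mult_pos)
  \<comment> \<open>The identity \<open>ln\<close> holds on \<open>S\<close> only;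
    \<open>convexD\<close> keeps the convex combinations in \<open>S\<close>, so it applies there
    too.\<close>
  from sum have "convex_on S (\<lambda>x. ln (f x * g x))"
    by (simp add: convex_on_def ln convexD)
  then show ?thesis
    using pos by (simp add: log_convex_on_def)
qed

text \<open>
  Hoelder's inequality with two terms: after division by the right-hand side it is the sum of two
  instances of the weighted AM-GM inequality.
\<close>

lemma powr_mult_powr_add_le:
  fixes p q r s u v :: real
  assumes "p > 0" "q > 0" "r > 0" "s > 0" "u \<ge> 0" "v \<ge> 0" "u + v = 1"
  shows "p powr u * q powr v + r powr u * s powr v \<le> (p + r) powr u * (q + s) powr v"
proof -
  let ?A = "p + r" and ?B = "q + s" and ?R = "(p + r) powr u * (q + s) powr v"
  have R: "?R > 0"
    using assms by simp
  have "p powr u * q powr v / ?R + r powr u * s powr v / ?R =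
        (p / ?A) powr u * (q / ?B) powr v + (r / ?A) powr u * (s / ?B) powr v"
    using assms by (simp add: powr_divide)
  also have "\<dots> \<le> (u * (p / ?A) + v * (q / ?B)) + (u * (r / ?A) + v * (s / ?B))"
    using assms by (intro add_mono Youngs_inequality_0) auto
  also have "\<dots> = u * ((p + r) / ?A) + v * ((q + s) / ?B)"
    by (simp only: add_divide_distrib distrib_left add_ac)
  also have "\<dots> = 1"
    using assms by simp
  finally show ?thesis
    using R by (simp only: divide_le_eq_1_pos flip: add_divide_distrib)
qed

lemma log_convex_on_add:
  assumes "log_convex_on S f" "log_convex_on S g"
  shows "log_convex_on S (\<lambda>x. f x + g x)"
  unfolding log_convex_on_iff
proof (intro conjI ballI allI impI)
  show "convex S"
    using assms(1) by (rule log_convex_on_imp_convex)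
  show "f x + g x > 0" if "x \<in> S" for x
    using assms that by (simp add: add_pos_pos log_convex_on_pos)
  fix x y and u v :: real
  assume *: "x \<in> S" "y \<in> S" "u \<ge> 0" "v \<ge> 0" "u + v = 1"
  have "f (u *\<^sub>R x + v *\<^sub>R y) + g (u *\<^sub>R x + v *\<^sub>R y) \<le>
        f x powr u * f y powr v + g x powr u * g y powr v"
    using assms * by (intro add_mono) (auto simp: log_convex_on_iff)
  also have "\<dots> \<le> (f x + g x) powr u * (f y + g y) powr v"
    using assms * by (intro powr_mult_powr_add_le) (auto simp: log_convex_on_pos)
  finally show "f (u *\<^sub>R x + v *\<^sub>R y) + g (u *\<^sub>R x + v *\<^sub>R y) \<le>
      (f x + g x) powr u * (f y + g y) powr v" .
qed

text \<open>The index set must be nonempty because the empty sum is 0, which is not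
  positive.\<close>

lemma log_convex_on_sum:
  assumes "finite I" "I \<noteq> {}" "\<And>i. i \<in> I \<Longrightarrow> log_convex_on S (f i)"
  shows "log_convex_on S (\<lambda>x. \<Sum>i\<in>I. f i x)"
  using assms by (induction I rule: finite_ne_induct) (simp_all add: log_convex_on_add)

lemma log_convex_on_const:
  assumes "convex S" "c > 0"
  shows "log_convex_on S (\<lambda>_. c)"
  using assms by (simp add: log_convex_on_def convex_on_const)

text \<open>The inner function is convex, so monotonicity of \<open>g\<close> bounds the left-hand
  side by \<open>g\<close> at a convex combination of \<open>f x\<close> and \<open>f y\<close>;
  log-convexity of \<open>g\<close> finishes.\<close>

lemma log_convex_on_compose:
  assumes f: "log_convex_on S f" and g: "log_convex_on {0<..} g" and mono: "mono_on {0<..} g"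
  shows "log_convex_on S (\<lambda>x. g (f x))"
  unfolding log_convex_on_iff
proof (intro conjI ballI allI impI)
  show "convex S"
    using f by (rule log_convex_on_imp_convex)
  show "g (f x) > 0" if "x \<in> S" for x
    using f g that by (simp add: log_convex_on_pos)
  fix x y and u v :: real
  assume *: "x \<in> S" "y \<in> S" "u \<ge> 0" "v \<ge> 0" "u + v = 1"
  have "u *\<^sub>R x + v *\<^sub>R y \<in> S"
    using * \<open>convex S\<close> by (simp add: convexD)
  then have pos: "f x > 0" "f y > 0" "f (u *\<^sub>R x + v *\<^sub>R y) > 0"
    using f * by (auto simp: log_convex_on_pos)
  have "f (u *\<^sub>R x + v *\<^sub>R y) \<le> u *\<^sub>R f x + v *\<^sub>R f y"
    using log_convex_on_imp_convex_on[OF f] * by (simp add: convex_on_def)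
  with pos have "g (f (u *\<^sub>R x + v *\<^sub>R y)) \<le> g (u *\<^sub>R f x + v *\<^sub>R f y)"
    by (intro mono_onD[OF mono]) auto
  also have "\<dots> \<le> g (f x) powr u * g (f y) powr v"
    using g pos * unfolding log_convex_on_iff by auto
  finally show "g (f (u *\<^sub>R x + v *\<^sub>R y)) \<le> g (f x) powr u * g (f y) powr v" .
qed

text \<open>The second derivative of \<open>ln (f t)\<close> is
  \<open>(f'' t * f t - (f' t)\<^sup>2) / (f t)\<^sup>2\<close>, and the last hypothesis makes its
  numerator nonnegative.\<close>

lemma log_convex_on_greaterThan_0I:
  fixes f f' f'' :: "real \<Rightarrow> real"
  assumes "\<And>t. t > 0 \<Longrightarrow> (f has_real_derivative f' t) (at t)"
    and "\<And>t. t > 0 \<Longrightarrow> (f' has_real_derivative f'' t) (at t)"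
    and pos: "\<And>t. t > 0 \<Longrightarrow> f t > 0"
    and "\<And>t. t > 0 \<Longrightarrow> f'' t * f t \<ge> (f' t)\<^sup>2"
  shows "log_convex_on {0<..} f"
proof -
  have "convex_on {0<..} (\<lambda>t. ln (f t))"
  proof (rule f''_ge0_imp_convex)
    fix t :: real
    assume "t \<in> {0<..}"
    then have t: "t > 0"
      by simp
    show "((\<lambda>t. ln (f t)) has_real_derivative f' t / f t) (at t)"
      using assms(1)[OF t] pos[OF t] by (auto intro!: derivative_eq_intros)
    show "((\<lambda>t. f' t / f t) has_real_derivative (f'' t * f t - f' t * f' t) / (f t * f t)) (at t)"
      using DERIV_divide[OF assms(2)[OF t] assms(1)[OF t]] pos[OF t] by simp
    show "(f'' t * f t - f' t * f' t) / (f t * f t) \<ge> 0"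
      using assms(4)[OF t] by (simp add: power2_eq_square)
  qed simp
  then show ?thesis
    using pos by (simp add: log_convex_on_def)
qed

section \<open>Log-convexity of the network layers in the weights\<close>

lemma lookup_scaleR: "Poly_Mapping.lookup (c *\<^sub>R w) p = c *\<^sub>R Poly_Mapping.lookup w p"
  by (simp add: scaleR_poly_mapping_def)

lemma convex_entry_vectors: "convex (entry_vectors n r c)"
proof -
  \<comment> \<open>The support condition becomes a family of homogeneous linear equations, so the
    set is a linear subspace.\<close>
  have "entry_vectors n r c = {w. \<forall>p. p \<notin> entry_positions n r c \<longrightarrow> Poly_Mapping.lookup w p = 0}"
    by (auto simp: entry_vectors_def in_keys_iff)
  then show ?thesis
    by (simp add: convex_def lookup_add lookup_scaleR)
qed

text \<open>The logarithm is the \<open>p\<close>-th coordinate of \<open>w\<close> times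
  \<open>ln a\<close>, which is linear in \<open>w\<close> whatever the sign of
  \<open>ln a\<close>.\<close>

lemma log_convex_on_powr_lookup:
  assumes "a > 0" "convex S"
  shows "log_convex_on S (\<lambda>w. a powr Poly_Mapping.lookup w p)"
  using assms
  by (auto simp: log_convex_on_def convex_on_def ln_powr lookup_add lookup_scaleR algebra_simps)

text \<open>Both factors of each product in the matrix-vector sum may depend on \<open>w\<close>,
  hence the need for closure under products. The bound \<open>c k \<ge> 1\<close> makes the sum
  nonempty.\<close>

lemma log_convex_on_exp_mat_mult_vec:
  assumes "a > 0" "c k \<ge> 1" "i < r k"
    and dim: "\<And>w. v w \<in> carrier_vec (c k)"
    and v: "\<And>j. j < c k \<Longrightarrow> log_convex_on S (\<lambda>w. v w $ j)"
  shows "log_convex_on S (\<lambda>w. (exp_mat a (matrices_of_entries r c w k) *\<^sub>v v w) $ i)"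
proof -
  have "(exp_mat a (matrices_of_entries r c w k) *\<^sub>v v w) $ i =
        (\<Sum>j\<in>{0..<c k}. a powr Poly_Mapping.lookup w (k, i, j) * v w $ j)" for w
    using dim[of w] \<open>i < r k\<close>
    by (simp add: exp_mat_def matrices_of_entries_def scalar_prod_def)
  moreover have "convex S"
    using v[of 0] \<open>c k \<ge> 1\<close> by (intro log_convex_on_imp_convex) auto
  ultimately show ?thesis
    using assms by (auto intro!: log_convex_on_sum log_convex_on_mult log_convex_on_powr_lookup)
qed

lemma exp_layer_carrier:
  assumes "x \<in> carrier_vec (d 0)"
  shows "exp_layer a \<sigma> (matrices_of_entries (\<lambda>k. d (Suc k)) d w) x k \<in> carrier_vec (d k)"
\<comment> \<open>Beyond the input, the dimension is the row count of the latest weight matrix, so a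
  case distinction replaces induction.\<close>
proof (cases k)
  case 0
  then show ?thesis
    using assms by simp
next
  case (Suc l)
  show ?thesis
    unfolding Suc by (rule carrier_vecI) (simp add: exp_mat_def matrices_of_entries_def)
qed

lemma log_convex_on_exp_layer:
  assumes "a > 0" "convex S" "x \<in> positive_vecs (d 0)"
    and \<sigma>: "log_convex_on {0<..} \<sigma>" "mono_on {0<..} \<sigma>"
    and "\<And>j. j < k \<Longrightarrow> d j \<ge> 1" "i < d k"
  shows "log_convex_on S
    (\<lambda>w. exp_layer a \<sigma> (matrices_of_entries (\<lambda>k. d (Suc k)) d w) x k $ i)"
  using assms(6,7)
\<comment> \<open>An entry of one layer uses all entries of the previous one, so \<open>i\<close> is
  generalized.\<close>
proof (induction k arbitrary: i)
  case 0
  then show ?case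
    \<comment> \<open>The input does not depend on \<open>w\<close>: its entries are positive
      constants.\<close>
    using assms by (auto simp: positive_vecs_def intro!: log_convex_on_const)
next
  case (Suc k)
  let ?M = "matrices_of_entries (\<lambda>k. d (Suc k)) d"
  have x: "x \<in> carrier_vec (d 0)"
    using assms(3) by (simp add: positive_vecs_def)
  have "log_convex_on S (\<lambda>w. (exp_mat a (?M w k) *\<^sub>v exp_layer a \<sigma> (?M w) x k) $ i)"
    using Suc \<open>a > 0\<close> by (intro log_convex_on_exp_mat_mult_vec exp_layer_carrier x) auto
  then have "log_convex_on S (\<lambda>w. \<sigma> ((exp_mat a (?M w k) *\<^sub>v exp_layer a \<sigma> (?M w) x k) $ i))"
    using \<sigma> by (rule log_convex_on_compose)
  \<comment> \<open>Within this bound, indexing \<open>map_vec\<close> gives \<open>\<sigma>\<close>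
    of the entry.\<close>
  moreover have "i < dim_vec (exp_mat a (?M w k) *\<^sub>v exp_layer a \<sigma> (?M w) x k)" for w
    using Suc.prems by (simp add: exp_mat_def matrices_of_entries_def)
  ultimately show ?case
    by simp
qed

theorem theorem4:
  fixes a :: real and \<sigma> \<sigma>' \<sigma>'' :: "real \<Rightarrow> real" and n :: nat and d :: "nat \<Rightarrow> nat"
  assumes "a > 0" and "a \<noteq> 1"
    and "\<And>t. (\<sigma> has_real_derivative \<sigma>' t) (at t)"
    and "\<And>t. (\<sigma>' has_real_derivative \<sigma>'' t) (at t)"
    and "\<And>t. t > 0 \<Longrightarrow> \<sigma> t > 0"
    and "\<And>t. t > 0 \<Longrightarrow> \<sigma>' t > 0"
    and "\<And>t. t > 0 \<Longrightarrow> \<sigma>'' t > 0"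
    and "\<And>t. t > 0 \<Longrightarrow> \<sigma>'' t * \<sigma> t \<ge> (\<sigma>' t)\<^sup>2"
    and "n \<ge> 1"
    and "\<And>k. k \<le> n \<Longrightarrow> d k \<ge> 1"
  shows "parameter_convex_nn n (\<lambda>k. d (Suc k)) d (d n) (positive_vecs (d 0)) (exp_network a \<sigma> n)"
  unfolding parameter_convex_nn_def convex_wrt_matrices_def
proof (intro ballI conjI allI impI)
  fix x
  assume x: "x \<in> positive_vecs (d 0)"
  then have x': "x \<in> carrier_vec (d 0)"
    by (simp add: positive_vecs_def)
  let ?M = "matrices_of_entries (\<lambda>k. d (Suc k)) d"
  \<comment> \<open>There are \<open>m\<close> activated layers, followed by the matrix with index
    \<open>m\<close> without activation.\<close>
  obtain m where n: "n = Suc m"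
    using \<open>n \<ge> 1\<close> by (cases n) auto
  show "exp_network a \<sigma> n x (?M w) \<in> carrier_vec (d n)" for w
    unfolding n exp_network_def
    by (rule carrier_vecI) (simp add: exp_mat_def matrices_of_entries_def)
  fix i
  assume "i < d n"
  have \<sigma>: "log_convex_on {0<..} \<sigma>"
    by (rule log_convex_on_greaterThan_0I[of _ \<sigma>' \<sigma>'']) (simp_all add: assms(3,4,5,8))
  have mono: "mono_on {0<..} \<sigma>"
  proof (rule mono_onI)
    fix s t :: real
    assume "s \<in> {0<..}" "s \<le> t"
    show "\<sigma> s \<le> \<sigma> t"
    proof (rule DERIV_nonneg_imp_nondecreasing[OF \<open>s \<le> t\<close>])
      \<comment> \<open>The sign of \<open>\<sigma>'\<close> is known on the positive axis; every
        \<open>y \<ge> s\<close> lies there since \<open>s\<close> is positive.\<close>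
      fix y
      assume "s \<le> y"
      with \<open>s \<in> {0<..}\<close> have "\<sigma>' y \<ge> 0"
        by (intro less_imp_le assms(6)) simp
      with assms(3) show "\<exists>D. (\<sigma> has_real_derivative D) (at y) \<and> D \<ge> 0"
        by blast
    qed
  qed
  have "log_convex_on (entry_vectors n (\<lambda>k. d (Suc k)) d)
      (\<lambda>w. (exp_mat a (?M w m) *\<^sub>v exp_layer a \<sigma> (?M w) x m) $ i)"
    using assms(1,9,10) n \<open>i < d n\<close> x
    by (intro log_convex_on_exp_mat_mult_vec exp_layer_carrier[where d = d] x'
          log_convex_on_exp_layer[where d = d] \<sigma> mono convex_entry_vectors) auto
  then show "convex_on (entry_vectors n (\<lambda>k. d (Suc k)) d)
      (\<lambda>w. exp_network a \<sigma> n x (?M w) $ i)"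
    unfolding n exp_network_def diff_Suc_1 by (rule log_convex_on_imp_convex_on)
qed

end
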